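(* Dekking's result yields that there exists an abelian $6$-power free morphism $h$ over the binary alphabet $\Sigma=\{a,b\}$ with a fixed point $\Omega_1'$ such that: (i) $aaaaaa$ is not a factor of $\Omega_1'$ (there are at most $5$ consecutive $a$'s in $\Omega_1'$); (ii) $bb$ is not a factor of $\Omega_1'$ (there are no two consecutive $b$'s in $\Omega_1'$); (iii) $\Omega_1'$ is abelian $6$-power free.
   Context: $\Sigma^*$ is the free monoid of finite words over $\Sigma$, with empty word $\epsilon$. A morphism $h$ over $\Sigma$ is a monoid homomorphism $h:\Sigma^*\to\Sigma^*$, extended letter by letter to infinite words; a fixed point of $h$ is an infinite word $\Omega\in\Sigma^{\mathbb{N}}$ with $h(\Omega)=\Omega$. A factor is a contiguous finite subword. The Parikh vector $\psi(u)$ of a finite word $u$ records the number of occurrences of each letter in $u$. A word $u$ (finite or infinite) is abelian $k$-power free if whenever $u=xv_1\cdots v_ky$ with $v_1,\dots,v_k$ finite words satisfying $\psi(v_1)=\cdots=\psi(v_k)$, one has $v_1=\cdots=v_k=\epsilon$. A morphism $h$ is abelian $n$-power free if $h(u)$ is abelian $n$-power free for every abelian $n$-power free word $u$. "Dekking's result", named in the claim as the tool from which the existence is obtained, is the following known sufficient criterion. Let $n>1$, let $h:\Sigma^*\to\Sigma^*$ be a morphism, $G$ a finite abelian group (written additively) and $f:\Sigma^*\to G$ a monoid morphism. Write $\operatorname{Pref}(h)$ for the set of all prefixes (including $\epsilon$ and the full word) of the words $h(\sigma)$, $\sigma\in\Sigma$, and $h(\Sigma)=\{h(\sigma):\sigma\in\Sigma\}$.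 Suppose: (D1) the frequency matrix of $h$, whose rows are the vectors $\psi(h(\sigma))$ for $\sigma\in\Sigma$, is non-singular; (D2) $f(h(\sigma))=0$ for each $\sigma\in\Sigma$; (D3) the set $f(\operatorname{Pref}(h))$ contains no arithmetic progression of length $n+1$ with non-zero common difference; (D4) for any positive integer $r$, if $f(v_1)=\cdots=f(v_r)$ with $v_i\in\operatorname{Pref}(h)\setminus h(\Sigma)$ for all $i$, then either $v_1=\cdots=v_r$ or $v_1'=\cdots=v_r'$, where $v_iv_i'=h(\sigma_{j_i})$ for some $\sigma_{j_i}\in\Sigma$. Then $h$ is an abelian $n$-power free morphism. *)

theory Defs
  imports Main "HOL-Library.Omega_Words_Fun"
begin

datatype letter = A | B

text \<open>Finite words are lists; infinite words are functions \<open>nat \<Rightarrow> 'a\<close>, and \<open>u \<frown> w\<close> is the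
  infinite word obtained by putting the finite word \<open>u\<close> in front of \<open>w\<close>.\<close>

definition monoid_morphism :: "('a list \<Rightarrow> 'b list) \<Rightarrow> bool" where
  "monoid_morphism h \<longleftrightarrow> h [] = [] \<and> (\<forall>u v. h (u @ v) = h u @ h v)"

text \<open>\<open>infinite_image h w x\<close> says that the infinite word \<open>x\<close> is the letter-by-letter image
  \<open>h(w\<^sub>0) h(w\<^sub>1) h(w\<^sub>2) \<dots>\<close> of \<open>w\<close>. It is a relation because an erasing morphism may send an
  infinite word to a finite one; the second conjunct excludes this case, and together with
  the first it determines \<open>x\<close> uniquely.\<close>

definition infinite_image :: "('a list \<Rightarrow> 'b list) \<Rightarrow> 'a word \<Rightarrow> 'b word \<Rightarrow> bool" where
  "infinite_image h w x \<longleftrightarrow>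
     (\<forall>n. \<exists>y. x = h (Omega_Words_Fun.prefix n w) \<frown> y) \<and>
     (\<forall>m. \<exists>n. m \<le> length (h (Omega_Words_Fun.prefix n w)))"

definition fixed_point :: "('a list \<Rightarrow> 'a list) \<Rightarrow> 'a word \<Rightarrow> bool" where
  "fixed_point h w \<longleftrightarrow> infinite_image h w w"

definition factor :: "'a list \<Rightarrow> 'a word \<Rightarrow> bool" where
  "factor u w \<longleftrightarrow> (\<exists>x y. w = x \<frown> u \<frown> y)"

definition parikh :: "'a list \<Rightarrow> 'a \<Rightarrow> nat" where
  "parikh u = (\<lambda>c. count_list u c)"

definition abelian_power_free :: "nat \<Rightarrow> 'a list \<Rightarrow> bool" where
  "abelian_power_free k u \<longleftrightarrow>
     (\<forall>x vs y. u = x @ concat vs @ y \<and> length vs = k \<and>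
        (\<forall>v\<in>set vs. \<forall>v'\<in>set vs. parikh v = parikh v') \<longrightarrow> (\<forall>v\<in>set vs. v = []))"

definition abelian_power_free_infinite :: "nat \<Rightarrow> 'a word \<Rightarrow> bool" where
  "abelian_power_free_infinite k w \<longleftrightarrow>
     (\<forall>x vs y. w = x \<frown> concat vs \<frown> y \<and> length vs = k \<and>
        (\<forall>v\<in>set vs. \<forall>v'\<in>set vs. parikh v = parikh v') \<longrightarrow> (\<forall>v\<in>set vs. v = []))"

text \<open>The argument ranges over finite and infinite words. If \<open>w\<close> is infinite but \<open>h(w)\<close> is finite
  (erasing \<open>h\<close>), then \<open>h(w)\<close> is the image of a finite prefix of \<open>w\<close>, so the first clause
  covers this case.\<close>

definition abelian_power_free_morphism :: "nat \<Rightarrow> ('a list \<Rightarrow> 'a list) \<Rightarrow> bool" where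
  "abelian_power_free_morphism n h \<longleftrightarrow> monoid_morphism h \<and>
     (\<forall>u. abelian_power_free n u \<longrightarrow> abelian_power_free n (h u)) \<and>
     (\<forall>w x. abelian_power_free_infinite n w \<and> infinite_image h w x
        \<longrightarrow> abelian_power_free_infinite n x)"

end

theory Submission
  imports Defs "HOL-Library.Multiset" "HOL-Library.Numeral_Type"
begin

text \<open>The morphism is \<open>a \<mapsto> aaaaab\<close>, \<open>b \<mapsto> aabab\<close>, and Dekking's criterion applies to it with
  \<open>G = \<int>/7\<close>, \<open>f(a) = 1\<close>, \<open>f(b) = 2\<close>: the proper prefixes of the images miss the value \<open>6\<close>, whereas
  seven terms in progression with non-zero difference exhaust \<open>\<int>/7\<close>.

  The criterion itself is proved by looking at the \<open>n + 1\<close> cut points of an abelian \<open>n\<close>-th power in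
  \<open>h(u)\<close>. The values of \<open>f\<close> on the prefixes of \<open>h(u)\<close> ending there form a progression, which by (D2)
  consists of values on proper prefixes of images of letters; by (D3) it is constant, and by (D4) all
  cuts can be moved simultaneously, by the same word, to cut points between images of letters. By (D1)
  the power then comes from an abelian \<open>n\<close>-th power in \<open>u\<close>.\<close>

section \<open>Abelian powers and infinite words\<close>

lemma parikh_eq_iff: "parikh u = parikh v \<longleftrightarrow> mset u = mset v"
  by (simp add: parikh_def count_mset multiset_eq_iff fun_eq_iff)

lemma abelian_power_free_iff:
  "abelian_power_free k u \<longleftrightarrow>
     (\<forall>x vs y. u = x @ concat vs @ y \<and> length vs = k \<and>
        (\<forall>v\<in>set vs. \<forall>v'\<in>set vs. mset v = mset v') \<longrightarrow> (\<forall>v\<in>set vs. v = []))"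
  by (simp add: abelian_power_free_def parikh_eq_iff)

lemma abelian_power_free_factor:
  assumes "abelian_power_free k (p @ u @ q)"
  shows "abelian_power_free k u"
  unfolding abelian_power_free_def
proof (intro allI impI)
  fix x vs y
  assume "u = x @ concat vs @ y \<and> length vs = k \<and>
    (\<forall>v\<in>set vs. \<forall>v'\<in>set vs. parikh v = parikh v')"
  then have "p @ u @ q = (p @ x) @ concat vs @ (y @ q) \<and> length vs = k \<and>
    (\<forall>v\<in>set vs. \<forall>v'\<in>set vs. parikh v = parikh v')"
    by (metis append_assoc)
  with assms show "\<forall>v\<in>set vs. v = []"
    unfolding abelian_power_free_def by blast
qed

lemma abelian_power_free_infinite_iff:
  "abelian_power_free_infinite k w \<longleftrightarrow> (\<forall>m. abelian_power_free k (Omega_Words_Fun.prefix m w))"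
proof
  assume inf: "abelian_power_free_infinite k w"
  show "\<forall>m. abelian_power_free k (Omega_Words_Fun.prefix m w)"
    unfolding abelian_power_free_def
  proof (intro allI impI)
    fix m x vs y
    assume *: "Omega_Words_Fun.prefix m w = x @ concat vs @ y \<and> length vs = k \<and>
      (\<forall>v\<in>set vs. \<forall>v'\<in>set vs. parikh v = parikh v')"
    then have "w = x \<frown> concat vs \<frown> (y \<frown> suffix m w)"
      by (metis conc_conc prefix_suffix)
    with * inf show "\<forall>v\<in>set vs. v = []"
      unfolding abelian_power_free_infinite_def by blast
  qed
next
  assume fin: "\<forall>m. abelian_power_free k (Omega_Words_Fun.prefix m w)"
  show "abelian_power_free_infinite k w"
    unfolding abelian_power_free_infinite_def
  proof (intro allI impI)
    fix x vs y
    assume *: "w = x \<frown> concat vs \<frown> y \<and> length vs = k \<and>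
      (\<forall>v\<in>set vs. \<forall>v'\<in>set vs. parikh v = parikh v')"
    then have "Omega_Words_Fun.prefix (length (x @ concat vs)) w = x @ concat vs"
      by (metis conc_conc prefix_conc_length)
    then have "Omega_Words_Fun.prefix (length (x @ concat vs)) w = x @ concat vs @ []"
      by simp
    with * fin show "\<forall>v\<in>set vs. v = []"
      unfolding abelian_power_free_def by blast
  qed
qed

text \<open>The images of finite prefixes of \<open>w\<close> grow without bound, so each prefix of
  \<open>x\<close> lies inside one of them. Hence the finite case settles the infinite clause of a
  power-free morphism.\<close>

lemma abelian_power_free_infinite_image:
  assumes h: "\<And>u. abelian_power_free k u \<Longrightarrow> abelian_power_free k (h u)"
    and w: "abelian_power_free_infinite k w" and x: "infinite_image h w x"
  shows "abelian_power_free_infinite k x"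
  unfolding abelian_power_free_infinite_iff
proof
  fix m
  obtain n where m: "m \<le> length (h (Omega_Words_Fun.prefix n w))"
    using x by (auto simp: infinite_image_def)
  define u where "u = h (Omega_Words_Fun.prefix n w)"
  obtain y where "x = u \<frown> y"
    using x by (auto simp: infinite_image_def u_def)
  then have "Omega_Words_Fun.prefix m x = take m u"
    using m by (simp add: u_def)
  moreover have "abelian_power_free k u"
    using h w by (simp add: u_def abelian_power_free_infinite_iff)
  then have "abelian_power_free k ([] @ take m u @ drop m u)"
    by simp
  ultimately show "abelian_power_free k (Omega_Words_Fun.prefix m x)"
    using abelian_power_free_factor by metis
qed

section \<open>Dekking's criterion\<close>

lemma morphism_Nil: "monoid_morphism h \<Longrightarrow> h [] = []"
  by (simp add: monoid_morphism_def)

lemma morphism_append: "monoid_morphism h \<Longrightarrow> h (u @ v) = h u @ h v"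
  by (simp add: monoid_morphism_def)

lemma morphism_Cons: "monoid_morphism h \<Longrightarrow> h (c # u) = h [c] @ h u"
  using morphism_append[of h "[c]" u] by simp

text \<open>Requiring \<open>v'\<close> to be nonempty assigns a cut between two blocks to the
  right-hand block, with \<open>v = []\<close>; only the end of the whole word has no such
  block.\<close>

lemma morphism_prefix_cases:
  assumes h: "monoid_morphism h" and "h u = p @ q"
  obtains "p = h u" "q = []"
  | u1 c u2 v v' where "u = u1 @ c # u2" "h [c] = v @ v'" "v' \<noteq> []" "p = h u1 @ v"
  using \<open>h u = p @ q\<close>
proof (induction u arbitrary: p thesis)
  case Nil
  then show ?case by (simp add: morphism_Nil[OF h])
next
  case (Cons c u)
  have "h [c] @ h u = p @ q"
    using Cons.prems(3) morphism_Cons[OF h] by metis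
  then consider (long) r where "p = h [c] @ r" "h u = r @ q"
    | (short) r where "h [c] = p @ r" "r \<noteq> []"
    unfolding append_eq_append_conv2 by (metis append_Nil append_Nil2)
  then show ?case
  proof cases
    case long
    show ?thesis
    proof (rule Cons.IH[OF _ _ long(2)])
      assume "r = h u" "q = []"
      then show thesis
        using Cons.prems(1) long(1) morphism_Cons[OF h] by metis
    next
      fix u1 d u2 v v'
      assume "u = u1 @ d # u2" "h [d] = v @ v'" "v' \<noteq> []" "r = h u1 @ v"
      then show thesis
        using Cons.prems(2)[of "c # u1" d u2 v v'] long(1) morphism_Cons[OF h, of c u1] by simp
    qed
  next
    case short
    then show ?thesis
      using Cons.prems(2)[of "[]" c u p r] morphism_Nil[OF h] by simp
  qed
qed

text \<open>The group is commutative, so \<open>f\<close> is a sum over the letters, regardless of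
  their order.\<close>

lemma additive_mset_cong:
  fixes f :: "'a list \<Rightarrow> 'g::ab_group_add"
  assumes f: "\<And>u v. f (u @ v) = f u + f v" and "mset u = mset v"
  shows "f u = f v"
proof -
  have f_mset: "f w = (\<Sum>c\<in>#mset w. f [c])" for w
  proof (induction w)
    case Nil
    show ?case using f[of "[]" "[]"] by simp
  next
    case (Cons c w)
    then show ?case using f[of "[c]" w] by simp
  qed
  show ?thesis
    using \<open>mset u = mset v\<close> by (simp add: f_mset[of u] f_mset[of v])
qed

text \<open>The \<open>U i\<close> are prefixes of one word, hence comparable, and a nonempty
  \<open>M\<close> forces them to grow. The gaps \<open>w i\<close> have images with Parikh vector
  \<open>M\<close>, so by \<open>D1\<close> they form an abelian \<open>n\<close>-th power in
  \<open>u\<close>.\<close>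

lemma abelian_power_desubstitute:
  assumes h: "monoid_morphism h"
    and D1: "\<And>u v. mset (h u) = mset (h v) \<Longrightarrow> mset u = mset v"
    and free: "abelian_power_free n u" and "n > 0"
    and pre: "\<And>i. i \<le> n \<Longrightarrow> \<exists>z. u = U i @ z"
    and step: "\<And>i. i < n \<Longrightarrow> mset (h (U (Suc i))) = mset (h (U i)) + M"
  shows "M = {#}"
proof (rule ccontr)
  assume M: "M \<noteq> {#}"
  have "\<exists>w. U (Suc i) = U i @ w" if i: "i < n" for i
  proof -
    from pre[of i] pre[of "Suc i"] i
    obtain z z' where "u = U i @ z" "u = U (Suc i) @ z'"
      by (metis Suc_leI less_imp_le)
    then consider w where "U (Suc i) = U i @ w" | w where "U i = U (Suc i) @ w"
      by (metis append_eq_append_conv2)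
    then show ?thesis
    proof cases
      case 2
      then have "mset (h (U i)) = mset (h (U i)) + M + mset (h w)"
        using step[OF i] by (simp add: morphism_append[OF h])
      then show ?thesis using M by simp
    qed blast
  qed
  then obtain w where w: "\<And>i. i < n \<Longrightarrow> U (Suc i) = U i @ w i"
    by metis
  have "mset (h (w i)) = M" if "i < n" for i
    using step[OF that] w[OF that] by (simp add: morphism_append[OF h])
  then have same: "mset (w i) = mset (w j)" if "i < n" "j < n" for i j
    using that D1 by metis
  have "U i = U 0 @ concat (map w [0..<i])" if "i \<le> n" for i
    using that by (induction i) (simp_all add: w)
  from this[of n] obtain z where "u = U 0 @ concat (map w [0..<n]) @ z"
    using pre[of n] by auto
  moreover have "\<forall>v\<in>set (map w [0..<n]). \<forall>v'\<in>set (map w [0..<n]). mset v = mset v'"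
    by (auto intro: same)
  moreover have "length (map w [0..<n]) = n"
    by simp
  ultimately have "\<forall>v\<in>set (map w [0..<n]). v = []"
    using free unfolding abelian_power_free_iff by blast
  then have "w 0 = []"
    using \<open>n > 0\<close> by auto
  then have "mset (h (U 0)) = mset (h (U 0)) + M"
    using step[of 0] w[of 0] \<open>n > 0\<close> by simp
  with M show False by simp
qed

text \<open>The assumption \<open>D1\<close> is equivalent to non-singularity of the frequency matrix: over a finite
  alphabet, a rational vector in the kernel yields two Parikh vectors with the same image. In \<open>D4\<close> it
  is enough to consider whole fibres of \<open>f\<close>.\<close>

theorem Dekking_criterion:
  fixes h :: "'a list \<Rightarrow> 'b list" and f :: "'b list \<Rightarrow> 'g::ab_group_add"
  assumes h: "monoid_morphism h"
    and D1: "\<And>u v. mset (h u) = mset (h v) \<Longrightarrow> mset u = mset v"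
    and f: "\<And>u v. f (u @ v) = f u + f v"
    and D2: "\<And>c. f (h [c]) = 0"
    and D3: "\<And>x d. \<lbrakk>\<And>i. i < n \<Longrightarrow> x (Suc i) = x i + d;
        \<And>i. i \<le> n \<Longrightarrow> \<exists>c v v'. h [c] = v @ v' \<and> v' \<noteq> [] \<and> x i = f v\<rbrakk> \<Longrightarrow> d = 0"
    and D4: "\<And>g. (\<exists>p. \<forall>c v v'. h [c] = v @ v' \<and> v' \<noteq> [] \<and> f v = g \<longrightarrow> v = p) \<or>
        (\<exists>s. \<forall>c v v'. h [c] = v @ v' \<and> v' \<noteq> [] \<and> f v = g \<longrightarrow> v' = s)"
    and free: "abelian_power_free n u"
  shows "abelian_power_free n (h u)"
  unfolding abelian_power_free_iff
proof (intro allI impI)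
  fix X vs Y
  assume "h u = X @ concat vs @ Y \<and> length vs = n \<and> (\<forall>v\<in>set vs. \<forall>v'\<in>set vs. mset v = mset v')"
  then have hu: "h u = X @ concat vs @ Y" and len: "length vs = n"
    and same: "\<And>v v'. v \<in> set vs \<Longrightarrow> v' \<in> set vs \<Longrightarrow> mset v = mset v'"
    by blast+
  show "\<forall>v\<in>set vs. v = []"
  proof (cases "vs = []")
    case False
    then have "n > 0" using len by auto
    define M where "M = mset (hd vs)"
    define d where "d = f (hd vs)"
    have vs_M: "mset v = M" if "v \<in> set vs" for v
      using same[OF that] False by (simp add: M_def)
    have vs_d: "f v = d" if "v \<in> set vs" for v
      using additive_mset_cong[of f, OF f] same[OF that] False by (metis d_def hd_in_set)
    define p where "p i = X @ concat (take i vs)" for i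
    have p_Suc: "p (Suc i) = p i @ vs ! i" if "i < n" for i
      using that len by (simp add: p_def take_Suc_conv_app_nth)
    have f_Nil: "f [] = 0"
      using f[of "[]" "[]"] by simp
    have f_h: "f (h w) = 0" for w
      by (induction w) (metis D2 add.left_neutral f f_Nil h morphism_Cons morphism_Nil)+
    \<comment> \<open>An erased letter would have the same image as the empty word, against
      \<open>D1\<close>.\<close>
    have h_ne: "h [c] \<noteq> []" for c
      using D1[of "[c]" "[]"] morphism_Nil[OF h] by auto
    \<comment> \<open>\<open>U\<close> collects the letters whose images are complete before the cut
      \<open>p i\<close>; \<open>v\<close> is the remainder inside the next image.\<close>
    have "\<exists>U v. p i = h U @ v \<and> ((U = u \<and> v = []) \<or>
        (\<exists>c z v'. u = U @ c # z \<and> h [c] = v @ v' \<and> v' \<noteq> []))" for i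
    proof -
      have "h u = p i @ (concat (drop i vs) @ Y)"
        using hu by (simp add: p_def flip: concat_append)
      from h this show ?thesis
        by (rule morphism_prefix_cases) auto
    qed
    then obtain U v where p_eq: "\<And>i. p i = h (U i) @ v i"
      and cut: "\<And>i. (U i = u \<and> v i = []) \<or>
        (\<exists>c z v'. u = U i @ c # z \<and> h [c] = v i @ v' \<and> v' \<noteq> [])"
      by metis
    \<comment> \<open>At the end of \<open>h u\<close> the remainder is empty, which is a proper
      prefix of the image of any letter.\<close>
    have proper: "\<exists>c v'. h [c] = v i @ v' \<and> v' \<noteq> []" for i
      using cut[of i] h_ne by (metis append_Nil)
    have f_v: "f (v i) = f (p i)" for i
      by (simp add: p_eq f f_h)
    have "d = 0"
    proof (rule D3[of "\<lambda>i. f (v i)"])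
      show "f (v (Suc i)) = f (v i) + d" if "i < n" for i
        using that len by (simp add: f_v p_Suc f vs_d)
    qed (use proper in blast)
    then have "f (p i) = f (p 0)" if "i \<le> n" for i
      using that by (induction i) (use len in \<open>auto simp: p_Suc f vs_d\<close>)
    then have f_v0: "f (v i) = f (v 0)" if "i \<le> n" for i
      using that by (metis f_v le0)
    have M_step: "mset (p (Suc i)) = mset (p i) + M" if "i < n" for i
      using that len vs_M by (simp add: p_Suc)
    have "M = {#}"
      using D4[of "f (v 0)"]
    proof (elim disjE exE)
      fix q assume "\<forall>c v' v''. h [c] = v' @ v'' \<and> v'' \<noteq> [] \<and> f v' = f (v 0) \<longrightarrow> v' = q"
      \<comment> \<open>Dropping the common remainder \<open>q\<close> moves every cut back to
        \<open>h (U i)\<close> and keeps the Parikh differences.\<close>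
      then have v: "v i = q" if "i \<le> n" for i
        using that proper f_v0 by blast
      show ?thesis
      proof (rule abelian_power_desubstitute[OF h D1 free \<open>n > 0\<close>, of U])
        show "\<exists>z. u = U i @ z" for i
          using cut[of i] by auto
        show "mset (h (U (Suc i))) = mset (h (U i)) + M" if "i < n" for i
          using M_step[OF that] that v[of i] v[of "Suc i"] by (simp add: p_eq)
      qed
    next
      fix s assume s: "\<forall>c v' v''. h [c] = v' @ v'' \<and> v'' \<noteq> [] \<and> f v' = f (v 0) \<longrightarrow> v'' = s"
      show ?thesis
      proof (cases "\<exists>i\<le>n. U i = u \<and> v i = []")
        case True
        \<comment> \<open>At the end of \<open>h(u)\<close> there is no complement, but the empty prefix lies in the fibre with
          every \<open>h [c]\<close> as its complement, which forces all the other prefixes to be empty too.\<close>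
        then have "f [] = f (v 0)"
          using f_v0 by metis
        then have "h [c] = s" for c
          using s h_ne by (metis append_Nil)
        then have v: "v i = []" if "i \<le> n" for i
          using proper[of i] s f_v0[OF that] by (metis append_self_conv2)
        show ?thesis
        proof (rule abelian_power_desubstitute[OF h D1 free \<open>n > 0\<close>, of U])
          show "\<exists>z. u = U i @ z" for i
            using cut[of i] by auto
          show "mset (h (U (Suc i))) = mset (h (U i)) + M" if "i < n" for i
            using M_step[OF that] that v[of i] v[of "Suc i"] by (simp add: p_eq)
        qed
      next
        case False
        \<comment> \<open>No cut is at the end of \<open>h u\<close>, so appending the common
          complement \<open>s\<close> moves each one forward to the end of the image of
          \<open>c i\<close>.\<close>
        then have "\<exists>c z. u = U i @ c # z \<and> h [c] = v i @ s" if "i \<le> n" for i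
          using that cut[of i] s f_v0[OF that] by metis
        then obtain c where c: "\<And>i. i \<le> n \<Longrightarrow> \<exists>z. u = U i @ c i # z"
          and h_c: "\<And>i. i \<le> n \<Longrightarrow> h [c i] = v i @ s"
          by metis
        have p_s: "h (U i @ [c i]) = p i @ s" if "i \<le> n" for i
          using h_c[OF that] by (simp add: morphism_append[OF h] p_eq)
        show ?thesis
        proof (rule abelian_power_desubstitute[OF h D1 free \<open>n > 0\<close>, of "\<lambda>i. U i @ [c i]"])
          show "\<exists>z. u = (U i @ [c i]) @ z" if "i \<le> n" for i
            using c[OF that] by auto
          show "mset (h (U (Suc i) @ [c (Suc i)])) = mset (h (U i @ [c i])) + M" if "i < n" for i
            using that M_step[OF that] by (simp add: p_s)
        qed
      qed
    qed
    then show ?thesis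
      using vs_M by auto
  qed simp
qed

section \<open>Fixed points\<close>

text \<open>Since \<open>h [c]\<close> properly extends \<open>[c]\<close> and \<open>h\<close>
  erases nothing, each iterate on \<open>c\<close> properly extends the previous one, and
  \<open>w\<close> is their limit. The second conclusion transfers properties of the iterates to
  \<open>w\<close>.\<close>

lemma morphism_fixed_point:
  assumes h: "monoid_morphism h" and ne: "\<And>a. h [a] \<noteq> []"
    and c: "h [c] = c # s" "s \<noteq> []"
  obtains w where "fixed_point h w"
    and "\<And>m. \<exists>k z. (h ^^ k) [c] = Omega_Words_Fun.prefix m w @ z"
proof -
  define P where "P k = (h ^^ k) [c]" for k
  have h_ne: "h u \<noteq> []" if "u \<noteq> []" for u
    using that ne by (cases u) (simp, metis append_is_Nil_conv h morphism_Cons)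
  have P_h: "h (P k) = P (Suc k)" for k
    by (simp add: P_def)
  have P_Suc: "\<exists>z. z \<noteq> [] \<and> P (Suc k) = P k @ z" for k
  proof (induction k)
    case 0
    show ?case using c by (simp add: P_def)
  next
    case (Suc k)
    then show ?case
      using h_ne P_h morphism_append[OF h] by metis
  qed
  have P_mono: "\<exists>z. P j = P i @ z" if "i \<le> j" for i j
    using that
  proof (induction rule: dec_induct)
    case (step j)
    then show ?case using P_Suc[of j] by auto
  qed simp
  have P_len: "k < length (P k)" for k
  proof (induction k)
    case (Suc k)
    obtain z where "z \<noteq> []" "P (Suc k) = P k @ z"
      using P_Suc by blast
    then show ?case
      using Suc by (cases z) simp_all
  qed (simp add: P_def)
  \<comment> \<open>Position \<open>i\<close> exists in \<open>P i\<close> by \<open>P_len\<close>,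
    and all iterates long enough agree there.\<close>
  define w where "w i = P i ! i" for i
  have w_P: "Omega_Words_Fun.prefix (length (P k)) w = P k" for k
  proof (rule nth_equalityI)
    fix i
    assume "i < length (Omega_Words_Fun.prefix (length (P k)) w)"
    then have i: "i < length (P k)" by simp
    have "P i ! i = P k ! i"
    proof (cases "i \<le> k")
      case True
      then show ?thesis using P_mono[of i k] P_len[of i] by (auto simp: nth_append)
    next
      case False
      then show ?thesis using P_mono[of k i] i by (auto simp: nth_append)
    qed
    with i show "Omega_Words_Fun.prefix (length (P k)) w ! i = P k ! i"
      by (simp add: w_def)
  qed simp
  have approx: "P m = Omega_Words_Fun.prefix m w @ drop m (P m)" for m
  proof -
    have "take m (P m) = take m (Omega_Words_Fun.prefix (length (P m)) w)"
      by (simp only: w_P)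
    also have "\<dots> = Omega_Words_Fun.prefix m w"
      using P_len[of m] by simp
    finally show ?thesis by (metis append_take_drop_id)
  qed
  have "fixed_point h w"
    unfolding fixed_point_def infinite_image_def
  proof (intro conjI allI)
    fix n
    have "P (Suc n) = h (Omega_Words_Fun.prefix n w) @ h (drop n (P n))"
      using approx[of n] P_h[of n] morphism_append[OF h] by metis
    moreover have "w = P (Suc n) \<frown> suffix (length (P (Suc n))) w"
      using w_P prefix_suffix by metis
    ultimately show "\<exists>y. w = h (Omega_Words_Fun.prefix n w) \<frown> y"
      by (metis conc_conc)
  next
    fix m
    have "m \<le> length (h (Omega_Words_Fun.prefix (length (P m)) w))"
      using P_len[of "Suc m"] by (simp add: w_P P_h)
    then show "\<exists>n. m \<le> length (h (Omega_Words_Fun.prefix n w))" ..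
  qed
  moreover have "\<exists>k z. (h ^^ k) [c] = Omega_Words_Fun.prefix m w @ z" for m
    using approx[of m] unfolding P_def by blast
  ultimately show thesis
    using that by blast
qed

section \<open>The morphism\<close>

fun letter_image :: "letter \<Rightarrow> letter list" where
  "letter_image A = [A, A, A, A, A, B]"
| "letter_image B = [A, A, B, A, B]"

definition hmor :: "letter list \<Rightarrow> letter list" where
  "hmor u = concat (map letter_image u)"

text \<open>The type \<open>7\<close> is the ring of integers modulo 7. The images weigh 5 + 2 and 3
  + 4, both zero there, which gives (D2).\<close>

fun letter_weight :: "letter \<Rightarrow> 7" where
  "letter_weight A = 1"
| "letter_weight B = 2"

definition weight :: "letter list \<Rightarrow> 7" where
  "weight u = sum_list (map letter_weight u)"

lemma hmor_simps [simp]: "hmor [] = []" "hmor (c # u) = letter_image c @ hmor u"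
  by (simp_all add: hmor_def)

lemma weight_simps [simp]: "weight [] = 0" "weight (c # u) = letter_weight c + weight u"
  by (simp_all add: weight_def)

lemma monoid_morphism_hmor: "monoid_morphism hmor"
  by (simp add: monoid_morphism_def hmor_def)

text \<open>Weights 0 to 3 determine the prefix, while 4 and 5 are shared by both images but
  determine the complement: this is (D4). Weight 6 is absent, as (D3) needs.\<close>

lemma proper_prefix_letter_image:
  assumes "letter_image c = v @ v'" "v' \<noteq> []"
  shows "(weight v, v) \<in> {(0, []), (1, [A]), (2, [A, A]), (3, [A, A, A])} \<or>
    (weight v, v') \<in> {(4, [A, B]), (5, [B])}"
proof (cases c)
  case A
  with assms have "(v, v') \<in> {([], [A, A, A, A, A, B]), ([A], [A, A, A, A, B]),
      ([A, A], [A, A, A, B]), ([A, A, A], [A, A, B]), ([A, A, A, A], [A, B]), ([A, A, A, A, A], [B])}"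
    by (simp add: Cons_eq_append_conv) blast
  then show ?thesis
    by (elim insertE emptyE) simp_all
next
  case B
  with assms have "(v, v') \<in> {([], [A, A, B, A, B]), ([A], [A, B, A, B]),
      ([A, A], [B, A, B]), ([A, A, B], [A, B]), ([A, A, B, A], [B])}"
    by (simp add: Cons_eq_append_conv) blast
  then show ?thesis
    by (elim insertE emptyE) simp_all
qed

lemma exhaust_7: "(x :: 7) \<in> {0, 1, 2, 3, 4, 5, 6}"
proof -
  obtain z :: int where "x = of_int z" "0 \<le> z" "z < 7"
    by (cases x rule: bit1_cases) simp
  moreover from this have "z \<in> {0, 1, 2, 3, 4, 5, 6}" by auto
  ultimately show ?thesis by auto
qed

lemma count_hmor:
  "count (mset (hmor u)) A = 5 * count (mset u) A + 3 * count (mset u) B"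
  "count (mset (hmor u)) B = count (mset u) A + 2 * count (mset u) B"
proof (induction u)
  case (Cons c u)
  { case 1 show ?case using Cons by (cases c) auto }
  { case 2 show ?case using Cons by (cases c) auto }
qed auto

text \<open>The frequency matrix in \<open>count_hmor\<close> has determinant 5 * 2 - 3 * 1 =
  7.\<close>

lemma mset_hmor_inject:
  assumes "mset (hmor u) = mset (hmor v)"
  shows "mset u = mset v"
proof -
  have "count (mset u) A = count (mset v) A \<and> count (mset u) B = count (mset v) B"
    using count_hmor[of u] count_hmor[of v] unfolding assms by linarith
  then have "count (mset u) c = count (mset v) c" for c
    by (cases c) auto
  then show ?thesis by (rule multiset_eqI)
qed

lemma abelian_6_power_free_hmor:
  assumes "abelian_power_free 6 u"
  shows "abelian_power_free 6 (hmor u)"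
proof (rule Dekking_criterion[where f = weight, OF monoid_morphism_hmor mset_hmor_inject _ _ _ _ assms])
  show "weight (u @ v) = weight u + weight v" for u v
    by (simp add: weight_def)
  show "weight (hmor [c]) = 0" for c
    by (cases c) simp_all
next
  fix x :: "nat \<Rightarrow> 7" and d
  assume step: "\<And>i. i < 6 \<Longrightarrow> x (Suc i) = x i + d"
    and val: "\<And>i. i \<le> 6 \<Longrightarrow> \<exists>c v v'. hmor [c] = v @ v' \<and> v' \<noteq> [] \<and> x i = weight v"
  have x: "x i = x 0 + of_nat i * d" if "i \<le> 6" for i
    using that by (induction i) (simp_all add: step algebra_simps)
  have "x i \<noteq> 6" if "i \<le> 6" for i
    using val[OF that] proper_prefix_letter_image by fastforce
  then have "x 0 + of_nat i * d \<noteq> 6" if "i \<le> 6" for i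
    using x[OF that] that by metis
  \<comment> \<open>As 7 is prime, a non-zero \<open>d\<close> would make the seven terms run
    through all residues, including 6. This is checked over all pairs \<open>x 0\<close>,
    \<open>d\<close>.\<close>
  from this[of 0] this[of 1] this[of 2] this[of 3] this[of 4] this[of 5] this[of 6]
  show "d = 0"
    using exhaust_7[of "x 0"] exhaust_7[of d] by (elim insertE emptyE) simp_all
next
  fix g :: 7
  show "(\<exists>p. \<forall>c v v'. hmor [c] = v @ v' \<and> v' \<noteq> [] \<and> weight v = g \<longrightarrow> v = p) \<or>
    (\<exists>s. \<forall>c v v'. hmor [c] = v @ v' \<and> v' \<noteq> [] \<and> weight v = g \<longrightarrow> v' = s)"
  proof (cases "g \<in> {4, 5}")
    case True
    then have "v' = (if g = 4 then [A, B] else [B])"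
      if "hmor [c] = v @ v'" "v' \<noteq> []" "weight v = g" for c v v'
      using that proper_prefix_letter_image[of c v v'] by auto
    then show ?thesis by blast
  next
    case False
    \<comment> \<open>The last branch covers \<open>g = 3\<close> and, vacuously, the empty fibre
      \<open>g = 6\<close>.\<close>
    then have "v = (if g = 0 then [] else if g = 1 then [A] else if g = 2 then [A, A] else [A, A, A])"
      if "hmor [c] = v @ v'" "v' \<noteq> []" "weight v = g" for c v v'
      using that proper_prefix_letter_image[of c v v'] by auto
    then show ?thesis by blast
  qed
qed

text \<open>Neither image contains \<open>BB\<close>, and both start with \<open>A\<close>, so none
  arises at a boundary either.\<close>

lemma successively_hmor: "successively (\<lambda>x y. x = B \<longrightarrow> y \<noteq> B) (hmor u)"
proof (induction u)
  case (Cons c u)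
  have "hmor u = [] \<or> hd (hmor u) = A"
  proof (cases u)
    case (Cons d u')
    then show ?thesis by (cases d) simp_all
  qed simp
  with Cons show ?case
    by (cases c) (auto simp: successively_append_iff successively_Cons)
qed simp

theorem theorem2p19:
  shows "\<exists>(h :: letter list \<Rightarrow> letter list) (\<Omega> :: letter word).
           abelian_power_free_morphism 6 h \<and> fixed_point h \<Omega> \<and>
           \<not> factor [A, A, A, A, A, A] \<Omega> \<and>
           \<not> factor [B, B] \<Omega> \<and>
           abelian_power_free_infinite 6 \<Omega>"
proof -
  have "hmor [c] \<noteq> []" for c
    by (cases c) simp_all
  then obtain \<Omega> where fixed: "fixed_point hmor \<Omega>"
    and approx: "\<And>m. \<exists>k z. (hmor ^^ k) [A] = Omega_Words_Fun.prefix m \<Omega> @ z"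
    by (rule morphism_fixed_point[OF monoid_morphism_hmor, of A "[A, A, A, A, B]"]) auto
  have "abelian_power_free 6 [A]"
    unfolding abelian_power_free_iff
  proof (intro allI impI)
    fix x y and vs :: "letter list list"
    assume *: "[A] = x @ concat vs @ y \<and> length vs = 6 \<and>
      (\<forall>v\<in>set vs. \<forall>v'\<in>set vs. mset v = mset v')"
    \<comment> \<open>Six abelian equivalent words have a total length divisible by 6, but only one
      letter is available.\<close>
    then have "\<forall>v\<in>set vs. length v = length (hd vs)"
      by (metis hd_in_set empty_iff empty_set mset_eq_length)
    then have "map length vs = replicate 6 (length (hd vs))"
      using * by (metis length_map map_replicate_const map_cong)
    then have "length (concat vs) = 6 * length (hd vs)"
      by (simp add: length_concat sum_list_replicate)
    moreover have "1 = length x + length (concat vs) + length y"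
      using arg_cong[OF conjunct1[OF *], of length] by simp
    ultimately have "length (hd vs) = 0"
      by linarith
    with \<open>\<forall>v\<in>set vs. length v = length (hd vs)\<close> show "\<forall>v\<in>set vs. v = []"
      by simp
  qed
  then have "abelian_power_free 6 ((hmor ^^ k) [A])" for k
    by (induction k) (simp_all add: abelian_6_power_free_hmor)
  then have "abelian_power_free 6 ([] @ Omega_Words_Fun.prefix m \<Omega> @ z)"
    if "(hmor ^^ k) [A] = Omega_Words_Fun.prefix m \<Omega> @ z" for k m z
    using that by (metis append_Nil)
  then have free: "abelian_power_free_infinite 6 \<Omega>"
    unfolding abelian_power_free_infinite_iff using approx abelian_power_free_factor by metis
  have "\<not> factor [A, A, A, A, A, A] \<Omega>"
  proof
    assume "factor [A, A, A, A, A, A] \<Omega>"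
    \<comment> \<open>Six consecutive letters \<open>A\<close> are themselves an abelian sixth
      power, so (i) follows from (iii).\<close>
    then obtain x y where "\<Omega> = x \<frown> concat (replicate 6 [A]) \<frown> y"
      by (auto simp: factor_def numeral_eq_Suc)
    then have "\<forall>v\<in>set (replicate 6 [A]). v = []"
      using free unfolding abelian_power_free_infinite_def
      by (metis in_set_replicate length_replicate)
    then show False by simp
  qed
  moreover have "\<not> factor [B, B] \<Omega>"
  proof
    assume "factor [B, B] \<Omega>"
    then obtain x y where \<Omega>: "\<Omega> = (x @ [B, B]) \<frown> y"
      by (auto simp: factor_def)
    obtain k z where "(hmor ^^ k) [A] = Omega_Words_Fun.prefix (length (x @ [B, B])) \<Omega> @ z"
      using approx by blast
    then have k: "(hmor ^^ k) [A] = x @ [B, B] @ z"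
      unfolding \<Omega> prefix_conc_length by simp
    \<comment> \<open>For \<open>k = 0\<close> this is a single letter; every later iterate is an
      image under \<open>hmor\<close>.\<close>
    have "successively (\<lambda>x y. x = B \<longrightarrow> y \<noteq> B) ((hmor ^^ k) [A])"
      by (cases k) (simp_all add: successively_hmor del: hmor_simps)
    then show False
      unfolding k by (simp add: successively_append_iff)
  qed
  moreover have "abelian_power_free_morphism 6 hmor"
    unfolding abelian_power_free_morphism_def
    using monoid_morphism_hmor abelian_6_power_free_hmor
      abelian_power_free_infinite_image[of 6 hmor] by blast
  ultimately show ?thesis
    using fixed free by blast
qed

end
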